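(* Let $p, T_1, T\in\mathbb{N}$ with $p\le T_1<T$, and let $\bm{X}_T=(X_1,\dots,X_T)$ be an order-$p$ parametric autoregressive time series with parameter space $\mathbb{T}$, as described in the context. Let $\hat\Theta_T=\hat\theta(X_1,\dots,X_{T_1})$ for an arbitrary (measurable) function $\hat\theta:\mathbb{X}^{T_1}\to\mathbb{T}$, and for $\theta\in\mathbb{T}$ put $$R_T(\theta)=\frac{L(\hat\Theta_T;\bm{X}_T)}{L(\theta;\bm{X}_T)},\qquad L(\theta;\bm{X}_T)=\prod_{t=T_1+1}^{T} f\left(X_t\mid X_{t-p},\dots,X_{t-1};\theta\right).$$ For $\alpha\in(0,1)$ define the random set $$\mathscr{C}^{\alpha}(\bm{X}_T)=\left\{\theta\in\mathbb{T}: R_T(\theta)\le 1/\alpha\right\}.$$ Then for every $\alpha\in(0,1)$ and every $\theta_0\in\mathbb{T}$, $$\mathrm{Pr}_{\theta_0}\left(\theta_0\in\mathscr{C}^{\alpha}(\bm{X}_T)\right)\ge 1-\alpha.$$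
   Context: Setting. $\mathbb{X}$ is a measurable space with a $\sigma$-finite reference measure, written $\mathrm{d}x$; $\mathbb{T}$ is a measurable parameter space. For each $\theta\in\mathbb{T}$ there are given a probability density function (PDF) $f(x_1,\dots,x_p;\theta)$ on $\mathbb{X}^p$ (with respect to the product reference measure) and a conditional PDF $f(x\mid z;\theta)\ge 0$, $x\in\mathbb{X}$, $z\in\mathbb{X}^p$, with $\int_{\mathbb{X}} f(x\mid z;\theta)\,\mathrm{d}x=1$ for every $z\in\mathbb{X}^p$. The densities are jointly measurable in all arguments, including $\theta$. $\mathrm{Pr}_\theta$ denotes the probability measure under which $(X_1,\dots,X_p)$ has PDF $f(\cdot;\theta)$ and, for each $t>p$, the conditional law of $X_t$ given $\mathcal{F}_{t-1}=\sigma(X_1,\dots,X_{t-1})$ has PDF $f(\cdot\mid X_{t-p},\dots,X_{t-1};\theta)$. Equivalently, $\bm{X}_T$ has joint PDF $$f(x_1,\dots,x_p;\theta)\prod_{t=p+1}^{T} f(x_t\mid x_{t-p},\dots,x_{t-1};\theta).$$ Convention: a likelihood ratio with zero denominator is assigned the value $+\infty$ (for $R_T(\theta)$ this happens with $\mathrm{Pr}_\theta$-probability zero). *)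

theory Defs
  imports "HOL-Probability.Probability"
begin

text \<open>A tuple \<open>(x\<^sub>1, \<dots>, x\<^sub>n)\<close> over the space of \<open>M\<close> is a point of
  \<open>PiM {1..n} (\<lambda>_. M)\<close>. The lagged tuple \<open>(x\<^bsub>t-p\<^esub>, \<dots>, x\<^bsub>t-1\<^esub>)\<close> is re-indexed by
  \<open>{1..p}\<close>; it is only used for \<open>t > p\<close>, so the natural-number subtractions do not truncate.\<close>

definition lags :: "nat \<Rightarrow> (nat \<Rightarrow> 'x) \<Rightarrow> nat \<Rightarrow> nat \<Rightarrow> 'x" where
  "lags p x t = (\<lambda>i\<in>{1..p}. x (t - p + (i - 1)))"

definition joint_pdf ::
  "nat \<Rightarrow> ((nat \<Rightarrow> 'x) \<Rightarrow> 't \<Rightarrow> real) \<Rightarrow> ('x \<Rightarrow> (nat \<Rightarrow> 'x) \<Rightarrow> 't \<Rightarrow> real) \<Rightarrow> nat \<Rightarrow> 't \<Rightarrow> (nat \<Rightarrow> 'x) \<Rightarrow> real"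
where
  "joint_pdf p f0 f T \<theta> x =
     f0 (restrict x {1..p}) \<theta> * (\<Prod>t\<in>{p+1..T}. f (x t) (lags p x t) \<theta>)"

text \<open>\<open>M\<close> carries the reference measure. Only the measurable-space structure of \<open>N\<close>, the
  parameter space, is used. \<open>f0 z \<theta>\<close> is the initial density \<open>f(z; \<theta>)\<close> and \<open>f x z \<theta>\<close> is the
  transition density \<open>f(x | z; \<theta>)\<close>. The law of the series under \<open>Pr \<theta>\<close> is prescribed
  through the joint density of \<open>(X\<^sub>1, \<dots>, X\<^sub>T)\<close>.\<close>

locale ar_time_series = sigma_finite_measure M
  for M :: "'x measure" +
  fixes N :: "'t measure"
    and p :: nat
    and f0 :: "(nat \<Rightarrow> 'x) \<Rightarrow> 't \<Rightarrow> real"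
    and f :: "'x \<Rightarrow> (nat \<Rightarrow> 'x) \<Rightarrow> 't \<Rightarrow> real"
    and Pr :: "'t \<Rightarrow> 'w measure"
    and T :: nat
    and X :: "nat \<Rightarrow> 'w \<Rightarrow> 'x"
  assumes f0_measurable:
      "(\<lambda>(z, \<theta>). f0 z \<theta>) \<in> borel_measurable (PiM {1..p} (\<lambda>_. M) \<Otimes>\<^sub>M N)"
    and f0_nonneg:
      "\<And>z \<theta>. z \<in> space (PiM {1..p} (\<lambda>_. M)) \<Longrightarrow> \<theta> \<in> space N \<Longrightarrow> 0 \<le> f0 z \<theta>"
    and f0_integral:
      "\<And>\<theta>. \<theta> \<in> space N \<Longrightarrow> (\<integral>\<^sup>+z. ennreal (f0 z \<theta>) \<partial>PiM {1..p} (\<lambda>_. M)) = 1"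
    and f_measurable:
      "(\<lambda>(x, z, \<theta>). f x z \<theta>) \<in> borel_measurable (M \<Otimes>\<^sub>M PiM {1..p} (\<lambda>_. M) \<Otimes>\<^sub>M N)"
    and f_nonneg:
      "\<And>x z \<theta>. x \<in> space M \<Longrightarrow> z \<in> space (PiM {1..p} (\<lambda>_. M)) \<Longrightarrow> \<theta> \<in> space N \<Longrightarrow> 0 \<le> f x z \<theta>"
    and f_integral:
      "\<And>z \<theta>. z \<in> space (PiM {1..p} (\<lambda>_. M)) \<Longrightarrow> \<theta> \<in> space N \<Longrightarrow>
         (\<integral>\<^sup>+x. ennreal (f x z \<theta>) \<partial>M) = 1"
    and Pr_prob_space: "\<And>\<theta>. \<theta> \<in> space N \<Longrightarrow> prob_space (Pr \<theta>)"
    and X_distributed: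
      "\<And>\<theta>. \<theta> \<in> space N \<Longrightarrow>
         distributed (Pr \<theta>) (PiM {1..T} (\<lambda>_. M)) (\<lambda>\<omega>. \<lambda>t\<in>{1..T}. X t \<omega>)
           (\<lambda>x. ennreal (joint_pdf p f0 f T \<theta> x))"

definition cond_likelihood ::
  "nat \<Rightarrow> ('x \<Rightarrow> (nat \<Rightarrow> 'x) \<Rightarrow> 't \<Rightarrow> real) \<Rightarrow> nat \<Rightarrow> nat \<Rightarrow> 't \<Rightarrow> (nat \<Rightarrow> 'x) \<Rightarrow> real"
where
  "cond_likelihood p f T1 T \<theta> x = (\<Prod>t\<in>{T1+1..T}. f (x t) (lags p x t) \<theta>)"

text \<open>A zero denominator gives the value \<open>\<infinity>\<close>. The case distinction is needed because
  \<open>0 / 0 = 0\<close> in \<^typ>\<open>ennreal\<close>.\<close>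

definition likelihood_ratio ::
  "nat \<Rightarrow> ('x \<Rightarrow> (nat \<Rightarrow> 'x) \<Rightarrow> 't \<Rightarrow> real) \<Rightarrow> nat \<Rightarrow> nat \<Rightarrow> ((nat \<Rightarrow> 'x) \<Rightarrow> 't) \<Rightarrow> 't \<Rightarrow> (nat \<Rightarrow> 'x) \<Rightarrow> ennreal"
where
  "likelihood_ratio p f T1 T \<theta>hat \<theta> x =
     (if cond_likelihood p f T1 T \<theta> x = 0 then \<infinity>
      else ennreal (cond_likelihood p f T1 T (\<theta>hat (restrict x {1..T1})) x
                    / cond_likelihood p f T1 T \<theta> x))"

definition confidence_set ::
  "'t measure \<Rightarrow> nat \<Rightarrow> ('x \<Rightarrow> (nat \<Rightarrow> 'x) \<Rightarrow> 't \<Rightarrow> real) \<Rightarrow> nat \<Rightarrow> nat \<Rightarrow> ((nat \<Rightarrow> 'x) \<Rightarrow> 't) \<Rightarrow> real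
    \<Rightarrow> (nat \<Rightarrow> 'x) \<Rightarrow> 't set"
where
  "confidence_set N p f T1 T \<theta>hat \<alpha> x =
     {\<theta> \<in> space N. likelihood_ratio p f T1 T \<theta>hat \<theta> x \<le> ennreal (1 / \<alpha>)}"

end

theory Submission
  imports Defs
begin

text \<open>Since \<open>\<theta>hat\<close> depends only on the first \<open>T1\<close> observations, replacing \<open>\<theta>0\<close> by \<open>\<theta>hat\<close> in the
  transition factors after time \<open>T1\<close> turns the joint density under \<open>\<theta>0\<close> into another
  probability density: integrate out \<open>x\<^sub>T, \<dots>, x\<^bsub>T1+1\<^esub>\<close> one at a time. So the likelihood
  ratio has expectation at most 1 under \<open>Pr \<theta>0\<close>, and Markov's inequality gives the bound.\<close>

text \<open>The lag tuple at time \<open>t\<close> reads only the coordinates \<open>t - p\<close>,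
  ..., \<open>t - 1\<close>. Hence \<open>t = Suc n\<close> is allowed: the conditioning tuple of
  the next observation is a function of the first \<open>n\<close>. The bound \<open>p < t\<close>
  keeps all indices at least 1.\<close>

lemma measurable_lags:
  assumes "p < t" "t \<le> Suc n"
  shows "(\<lambda>x. lags p x t) \<in> measurable (PiM {1..n} (\<lambda>_. M)) (PiM {1..p} (\<lambda>_. M))"
  unfolding lags_def using assms
  by (intro measurable_restrict measurable_component_singleton) auto

lemma lags_cong:
  assumes "p < t" "\<And>i. 1 \<le> i \<Longrightarrow> i < t \<Longrightarrow> x i = y i"
  shows "lags p x t = lags p y t"
  unfolding lags_def using assms by (intro restrict_ext) auto

text \<open>The earliest index read by a factor is \<open>m + 1 - p\<close>, which is at least 1
  since \<open>p \<le> m\<close>. This justifies both truncating a path and changing it at time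
  \<open>Suc n\<close>.\<close>

lemma cond_likelihood_cong:
  assumes "p \<le> m" "\<And>i. 1 \<le> i \<Longrightarrow> i \<le> n \<Longrightarrow> x i = y i"
  shows "cond_likelihood p f m n \<theta> x = cond_likelihood p f m n \<theta> y"
  unfolding cond_likelihood_def
proof (intro prod.cong refl)
  fix t assume "t \<in> {m+1..n}"
  moreover from this assms have "lags p x t = lags p y t"
    by (intro lags_cong) auto
  ultimately show "f (x t) (lags p x t) \<theta> = f (y t) (lags p y t) \<theta>"
    using assms by auto
qed

lemma cond_likelihood_Suc:
  assumes "m \<le> n"
  shows "cond_likelihood p f m (Suc n) \<theta> x =
    cond_likelihood p f m n \<theta> x * f (x (Suc n)) (lags p x (Suc n)) \<theta>"
  using assms unfolding cond_likelihood_def by (simp add: prod.nat_ivl_Suc')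

lemma joint_pdf_eq_cond_likelihood:
  "joint_pdf p f0 f n \<theta> x = f0 (restrict x {1..p}) \<theta> * cond_likelihood p f p n \<theta> x"
  by (simp add: joint_pdf_def cond_likelihood_def)

text \<open>Factors up to time \<open>m\<close> do not look past \<open>m\<close>, hence the
  restriction. The split isolates the factors in which the parameter will later be
  exchanged.\<close>

lemma joint_pdf_split:
  assumes "p \<le> m" "m \<le> n"
  shows "joint_pdf p f0 f n \<theta> x =
    joint_pdf p f0 f m \<theta> (restrict x {1..m}) * cond_likelihood p f m n \<theta> x"
proof -
  have "{p+1..n} = {p+1..m} \<union> {m+1..n}" using assms by auto
  then have "cond_likelihood p f p n \<theta> x = cond_likelihood p f p m \<theta> x * cond_likelihood p f m n \<theta> x"
    unfolding cond_likelihood_def by (simp add: prod.union_disjoint)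
  moreover have "cond_likelihood p f p m \<theta> (restrict x {1..m}) = cond_likelihood p f p m \<theta> x"
    by (rule cond_likelihood_cong) auto
  moreover have "restrict (restrict x {1..m}) {1..p} = restrict x {1..p}" using assms by auto
  ultimately show ?thesis
    by (simp only: mult.assoc joint_pdf_eq_cond_likelihood)
qed

context ar_time_series
begin

text \<open>The parameter may vary with the path, so that a plug-in estimator is covered; this is
  where joint measurability of \<open>f\<close> in the parameter enters.\<close>

lemma measurable_cond_likelihood:
  assumes "p \<le> m" and h: "h \<in> measurable (PiM {1..n} (\<lambda>_. M)) N"
  shows "(\<lambda>x. cond_likelihood p f m n (h x) x) \<in> borel_measurable (PiM {1..n} (\<lambda>_. M))"
  unfolding cond_likelihood_def
proof (intro borel_measurable_prod)
  fix t assume t: "t \<in> {m+1..n}"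
  have "(\<lambda>x. (x t, lags p x t, h x)) \<in> measurable (PiM {1..n} (\<lambda>_. M))
      (M \<Otimes>\<^sub>M PiM {1..p} (\<lambda>_. M) \<Otimes>\<^sub>M N)"
    using t assms
    by (intro measurable_Pair measurable_lags measurable_component_singleton) auto
  from measurable_compose[OF this f_measurable]
  show "(\<lambda>x. f (x t) (lags p x t) (h x)) \<in> borel_measurable (PiM {1..n} (\<lambda>_. M))"
    by simp
qed

lemma cond_likelihood_nonneg:
  assumes "p \<le> m" "x \<in> space (PiM {1..n} (\<lambda>_. M))" "\<theta> \<in> space N"
  shows "0 \<le> cond_likelihood p f m n \<theta> x"
  unfolding cond_likelihood_def
proof (intro prod_nonneg ballI f_nonneg \<open>\<theta> \<in> space N\<close>)
  fix t assume t: "t \<in> {m+1..n}"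
  then show "x t \<in> space M"
    using assms by (auto simp: space_PiM PiE_def Pi_def)
  show "lags p x t \<in> space (PiM {1..p} (\<lambda>_. M))"
    using t assms by (intro measurable_space[OF measurable_lags]) auto
qed

lemma measurable_f0_restrict:
  assumes "p \<le> n" "\<theta> \<in> space N"
  shows "(\<lambda>x. f0 (restrict x {1..p}) \<theta>) \<in> borel_measurable (PiM {1..n} (\<lambda>_. M))"
proof -
  have "(\<lambda>x. (restrict x {1..p}, \<theta>)) \<in> measurable (PiM {1..n} (\<lambda>_. M)) (PiM {1..p} (\<lambda>_. M) \<Otimes>\<^sub>M N)"
    using assms by (intro measurable_Pair measurable_restrict_subset measurable_const) auto
  from measurable_compose[OF this f0_measurable] show ?thesis by simp
qed

lemma measurable_joint_pdf:
  assumes "p \<le> n" "\<theta> \<in> space N"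
  shows "joint_pdf p f0 f n \<theta> \<in> borel_measurable (PiM {1..n} (\<lambda>_. M))"
  unfolding joint_pdf_eq_cond_likelihood[abs_def] using assms
  by (intro borel_measurable_times measurable_f0_restrict measurable_cond_likelihood) auto

lemma joint_pdf_nonneg:
  assumes "p \<le> n" "x \<in> space (PiM {1..n} (\<lambda>_. M))" "\<theta> \<in> space N"
  shows "0 \<le> joint_pdf p f0 f n \<theta> x"
  unfolding joint_pdf_eq_cond_likelihood
proof (intro mult_nonneg_nonneg f0_nonneg cond_likelihood_nonneg)
  show "restrict x {1..p} \<in> space (PiM {1..p} (\<lambda>_. M))"
    using assms by (intro measurable_space[OF measurable_restrict_subset]) auto
qed (use assms in auto)

text \<open>The last coordinate occurs only in the last transition factor, whose lags and parameter
  are fixed by earlier coordinates, so that factor integrates to 1. It is essential that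
  \<open>h\<close> sees only the first \<open>m\<close> coordinates. Constant \<open>h\<close> gives
  the total mass of the joint density; \<open>h = \<theta>hat\<close> gives the plug-in
  version.\<close>

lemma nn_integral_cond_likelihood:
  assumes "p \<le> m" "m \<le> n"
    and g: "g \<in> borel_measurable (PiM {1..m} (\<lambda>_. M))"
    and h: "h \<in> measurable (PiM {1..m} (\<lambda>_. M)) N"
  shows "(\<integral>\<^sup>+x. g (restrict x {1..m}) *
      ennreal (cond_likelihood p f m n (h (restrict x {1..m})) x) \<partial>PiM {1..n} (\<lambda>_. M)) =
    (\<integral>\<^sup>+x. g x \<partial>PiM {1..m} (\<lambda>_. M))"
  using \<open>m \<le> n\<close>
proof (induction n rule: dec_induct)
  case base
  \<comment> \<open>The product is empty, and restriction fixes every point of the space by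
    extensionality.\<close>
  show ?case
    by (intro nn_integral_cong) (auto simp: cond_likelihood_def space_PiM)
next
  case (step n)
  interpret product_sigma_finite "\<lambda>_. M"
    by (rule product_sigma_finite.intro) (rule sigma_finite_measure_axioms)
  define G where "G k x = g (restrict x {1..m}) *
      ennreal (cond_likelihood p f m k (h (restrict x {1..m})) x)" for k x
  have restr: "(\<lambda>x. restrict x {1..m}) \<in> measurable (PiM {1..k} (\<lambda>_. M)) (PiM {1..m} (\<lambda>_. M))"
    if "m \<le> k" for k
    using that by (intro measurable_restrict_subset) auto
  have G_meas: "G k \<in> borel_measurable (PiM {1..k} (\<lambda>_. M))" if "m \<le> k" for k
    unfolding G_def
    by (intro borel_measurable_times_ennreal measurable_compose[OF restr[OF that] g]
        measurable_compose[OF _ measurable_ennreal] measurable_cond_likelihood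
        measurable_compose[OF restr[OF that] h] \<open>p \<le> m\<close>)
  \<comment> \<open>Splitting off the index \<open>Suc n\<close> lets Tonelli make the newest
    coordinate the inner integral.\<close>
  have ins: "{1..Suc n} = insert (Suc n) {1..n}" by auto
  have "(\<integral>\<^sup>+x. G (Suc n) x \<partial>PiM {1..Suc n} (\<lambda>_. M)) =
      (\<integral>\<^sup>+x. (\<integral>\<^sup>+y. G (Suc n) (x(Suc n := y)) \<partial>M) \<partial>PiM {1..n} (\<lambda>_. M))"
    using G_meas[of "Suc n"] step.hyps unfolding ins
    by (intro product_nn_integral_insert) auto
  also have "\<dots> = (\<integral>\<^sup>+x. G n x \<partial>PiM {1..n} (\<lambda>_. M))"
  proof (intro nn_integral_cong)
    fix x assume x: "x \<in> space (PiM {1..n} (\<lambda>_. M))"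
    define \<theta> where "\<theta> = h (restrict x {1..m})"
    define z where "z = lags p x (Suc n)"
    have \<theta>: "\<theta> \<in> space N"
      unfolding \<theta>_def using x restr[OF step.hyps(1)] h by (auto dest!: measurable_space)
    have z: "z \<in> space (PiM {1..p} (\<lambda>_. M))"
      unfolding z_def using x \<open>p \<le> m\<close> step.hyps
      by (intro measurable_space[OF measurable_lags]) auto
    \<comment> \<open>As a function of \<open>y\<close> only the last transition density varies: the
      estimate, the earlier factors and the lags at \<open>Suc n\<close> all ignore coordinate
      \<open>Suc n\<close>.\<close>
    have "G (Suc n) (x(Suc n := y)) = G n x * ennreal (f y z \<theta>)" if y: "y \<in> space M" for y
    proof -
      have r: "restrict (x(Suc n := y)) {1..m} = restrict x {1..m}"
        using step.hyps by (intro restrict_ext) auto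
      have "cond_likelihood p f m n \<theta> (x(Suc n := y)) = cond_likelihood p f m n \<theta> x"
        using \<open>p \<le> m\<close> by (intro cond_likelihood_cong) auto
      moreover have "lags p (x(Suc n := y)) (Suc n) = z"
        unfolding z_def using \<open>p \<le> m\<close> step.hyps by (intro lags_cong) auto
      ultimately show ?thesis
        unfolding G_def r \<theta>_def[symmetric] cond_likelihood_Suc[OF step.hyps(1)]
        using f_nonneg[OF y z \<theta>] cond_likelihood_nonneg[OF \<open>p \<le> m\<close> x \<theta>]
        by (simp add: ennreal_mult mult.assoc)
    qed
    then have "(\<integral>\<^sup>+y. G (Suc n) (x(Suc n := y)) \<partial>M) = (\<integral>\<^sup>+y. G n x * ennreal (f y z \<theta>) \<partial>M)"
      by (intro nn_integral_cong) auto
    also have "\<dots> = G n x * (\<integral>\<^sup>+y. ennreal (f y z \<theta>) \<partial>M)"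
    proof (rule nn_integral_cmult)
      have "(\<lambda>y. (y, z, \<theta>)) \<in> measurable M (M \<Otimes>\<^sub>M PiM {1..p} (\<lambda>_. M) \<Otimes>\<^sub>M N)"
        using z \<theta> by (intro measurable_Pair measurable_const measurable_ident_sets) auto
      from measurable_compose[OF this f_measurable]
      show "(\<lambda>y. ennreal (f y z \<theta>)) \<in> borel_measurable M" by simp
    qed
    also have "\<dots> = G n x" using f_integral[OF z \<theta>] by simp
    finally show "(\<integral>\<^sup>+y. G (Suc n) (x(Suc n := y)) \<partial>M) = G n x" .
  qed
  finally show ?case unfolding G_def step.IH .
qed

lemma nn_integral_joint_pdf:
  assumes "p \<le> n" "\<theta> \<in> space N"
  shows "(\<integral>\<^sup>+x. ennreal (joint_pdf p f0 f n \<theta> x) \<partial>PiM {1..n} (\<lambda>_. M)) = 1"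
proof -
  have r: "restrict x {1..p} \<in> space (PiM {1..p} (\<lambda>_. M))"
    if "x \<in> space (PiM {1..n} (\<lambda>_. M))" for x
    using assms that by (intro measurable_space[OF measurable_restrict_subset]) auto
  \<comment> \<open>The restriction is the identity on \<open>p\<close>-tuples, so the case
    \<open>n = p\<close> of \<open>measurable_f0_restrict\<close> yields measurability of the
    initial density itself.\<close>
  have "(\<lambda>z. ennreal (f0 (restrict z {1..p}) \<theta>)) \<in> borel_measurable (PiM {1..p} (\<lambda>_. M))"
    using measurable_f0_restrict[of p \<theta>] assms by auto
  also have "?this \<longleftrightarrow> (\<lambda>z. ennreal (f0 z \<theta>)) \<in> borel_measurable (PiM {1..p} (\<lambda>_. M))"
    by (intro measurable_cong) (auto simp: space_PiM)
  finally have m: "(\<lambda>z. ennreal (f0 z \<theta>)) \<in> borel_measurable (PiM {1..p} (\<lambda>_. M))" .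
  have "(\<integral>\<^sup>+x. ennreal (joint_pdf p f0 f n \<theta> x) \<partial>PiM {1..n} (\<lambda>_. M)) =
      (\<integral>\<^sup>+x. ennreal (f0 (restrict x {1..p}) \<theta>) * ennreal (cond_likelihood p f p n \<theta> x)
        \<partial>PiM {1..n} (\<lambda>_. M))"
    using assms r
    by (intro nn_integral_cong)
      (simp add: joint_pdf_eq_cond_likelihood ennreal_mult f0_nonneg cond_likelihood_nonneg)
  also have "\<dots> = 1"
    using nn_integral_cond_likelihood[of p n "\<lambda>z. ennreal (f0 z \<theta>)" "\<lambda>_. \<theta>"] m assms f0_integral
    by simp
  finally show ?thesis .
qed

end

theorem proposition1:
  fixes M :: "'x measure" and N :: "'t measure"
    and f0 :: "(nat \<Rightarrow> 'x) \<Rightarrow> 't \<Rightarrow> real"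
    and f :: "'x \<Rightarrow> (nat \<Rightarrow> 'x) \<Rightarrow> 't \<Rightarrow> real"
    and Pr :: "'t \<Rightarrow> 'w measure"
    and X :: "nat \<Rightarrow> 'w \<Rightarrow> 'x"
    and \<theta>hat :: "(nat \<Rightarrow> 'x) \<Rightarrow> 't"
    and p T1 T :: nat and \<alpha> :: real and \<theta>0 :: 't
  assumes "p \<le> T1" and "T1 < T"
    and "ar_time_series M N p f0 f Pr T X"
    and "\<theta>hat \<in> measurable (PiM {1..T1} (\<lambda>_. M)) N"
    and "0 < \<alpha>" and "\<alpha> < 1"
    and "\<theta>0 \<in> space N"
  shows "measure (Pr \<theta>0)
           {\<omega> \<in> space (Pr \<theta>0).
              \<theta>0 \<in> confidence_set N p f T1 T \<theta>hat \<alpha> (\<lambda>t\<in>{1..T}. X t \<omega>)} \<ge> 1 - \<alpha>"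
proof -
  interpret ar_time_series M N p f0 f Pr T X by fact
  interpret P: prob_space "Pr \<theta>0" using Pr_prob_space assms by blast
  let ?S = "PiM {1..T} (\<lambda>_. M)"
  define W where "W \<omega> = (\<lambda>t\<in>{1..T}. X t \<omega>)" for \<omega>
  \<comment> \<open>\<open>A\<close> is the density of the first \<open>T1\<close> observations
    under \<theta>0, \<open>L0\<close> and \<open>L1\<close> are the denominator and numerator of
    the ratio, and \<open>B\<close> is the set of samples whose confidence set misses
    \<theta>0.\<close>
  define A where "A x = joint_pdf p f0 f T1 \<theta>0 x" for x
  define L0 where "L0 x = cond_likelihood p f T1 T \<theta>0 x" for x
  define L1 where "L1 x = cond_likelihood p f T1 T (\<theta>hat (restrict x {1..T1})) x" for x
  define B where "B = {x \<in> space ?S. \<theta>0 \<notin> confidence_set N p f T1 T \<theta>hat \<alpha> x}"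
  have dist: "distributed (Pr \<theta>0) ?S W (\<lambda>x. ennreal (joint_pdf p f0 f T \<theta>0 x))"
    unfolding W_def[abs_def] using X_distributed assms by blast
  note W_meas = distributed_measurable[OF dist]
  have restr: "(\<lambda>x. restrict x {1..T1}) \<in> measurable ?S (PiM {1..T1} (\<lambda>_. M))"
    using assms by (intro measurable_restrict_subset) auto
  have hat: "(\<lambda>x. \<theta>hat (restrict x {1..T1})) \<in> measurable ?S N"
    using measurable_compose[OF restr] assms by blast
  have L0_meas[measurable]: "L0 \<in> borel_measurable ?S"
    unfolding L0_def using assms by (intro measurable_cond_likelihood) auto
  have L1_meas[measurable]: "L1 \<in> borel_measurable ?S"
    unfolding L1_def using assms hat by (intro measurable_cond_likelihood) auto
  have A_meas: "A \<in> borel_measurable (PiM {1..T1} (\<lambda>_. M))"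
    unfolding A_def using assms by (intro measurable_joint_pdf)
  have nn: "0 \<le> A (restrict x {1..T1})" "0 \<le> L0 x" "0 \<le> L1 x" if "x \<in> space ?S" for x
    unfolding A_def L0_def L1_def
    using assms that measurable_space[OF restr that] measurable_space[OF hat that]
    by (auto intro!: joint_pdf_nonneg cond_likelihood_nonneg)
  \<comment> \<open>By convention a zero denominator makes the ratio infinite, so such samples count
    as misses.\<close>
  have B_eq: "B = {x \<in> space ?S. L0 x = 0 \<or> 1 / \<alpha> < L1 x / L0 x}"
    using assms unfolding B_def confidence_set_def likelihood_ratio_def L0_def L1_def
    by (auto simp: top_unique not_le ennreal_less_iff)
  have B_sets: "B \<in> sets ?S" unfolding B_eq by measurable
  \<comment> \<open>This is Markov's inequality before integration. Stated without division, it also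
    covers \<open>L0 x = 0\<close>, where the joint density vanishes, so no separate null-set
    argument is required.\<close>
  have bound: "ennreal (joint_pdf p f0 f T \<theta>0 x) * indicator B x
      \<le> ennreal \<alpha> * (ennreal (A (restrict x {1..T1})) * ennreal (L1 x))"
    if x: "x \<in> space ?S" for x
  proof -
    have J: "joint_pdf p f0 f T \<theta>0 x = A (restrict x {1..T1}) * L0 x"
      unfolding A_def L0_def using assms by (intro joint_pdf_split) auto
    have "L0 x \<le> \<alpha> * L1 x" if "x \<in> B"
    proof (cases "L0 x = 0")
      case False
      then have "0 < L0 x" "1 / \<alpha> < L1 x / L0 x"
        using that nn[OF x] by (auto simp: B_eq)
      then show ?thesis using assms by (simp add: field_simps)
    qed (use nn[OF x] assms in simp)
    then have "A (restrict x {1..T1}) * L0 x \<le> \<alpha> * (A (restrict x {1..T1}) * L1 x)" if "x \<in> B"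
      using that nn[OF x] mult_left_mono by (fastforce simp: mult.left_commute)
    then show ?thesis
      using assms nn[OF x]
      by (auto simp: J indicator_def ennreal_mult[symmetric] intro!: ennreal_leI)
  qed
  have "emeasure (Pr \<theta>0) (W -` B \<inter> space (Pr \<theta>0)) =
      (\<integral>\<^sup>+x. ennreal (joint_pdf p f0 f T \<theta>0 x) * indicator B x \<partial>?S)"
    by (rule distributed_emeasure[OF dist B_sets])
  also have "\<dots> \<le> (\<integral>\<^sup>+x. ennreal \<alpha> * (ennreal (A (restrict x {1..T1})) * ennreal (L1 x)) \<partial>?S)"
    by (intro nn_integral_mono bound)
  also have "\<dots> = ennreal \<alpha> * (\<integral>\<^sup>+x. ennreal (A (restrict x {1..T1})) * ennreal (L1 x) \<partial>?S)"
    using measurable_compose[OF restr A_meas] L1_meas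
    by (intro nn_integral_cmult borel_measurable_times_ennreal measurable_compose[OF _ measurable_ennreal])
  \<comment> \<open>Integrating out the plug-in factors after time \<open>T1\<close> leaves the
    total mass of the density \<open>A\<close>.\<close>
  also have "(\<integral>\<^sup>+x. ennreal (A (restrict x {1..T1})) * ennreal (L1 x) \<partial>?S) = 1"
    unfolding L1_def
    using nn_integral_cond_likelihood[of T1 T "\<lambda>x. ennreal (A x)" \<theta>hat] assms
      measurable_compose[OF A_meas measurable_ennreal]
      nn_integral_joint_pdf[of T1 \<theta>0]
    by (simp add: A_def)
  finally have "P.prob (W -` B \<inter> space (Pr \<theta>0)) \<le> \<alpha>"
    using assms by (simp add: P.emeasure_eq_measure)
  \<comment> \<open>Coverage is the complement of the event that the sample falls in
    \<open>B\<close>, so the bound \<alpha> on the latter suffices.\<close>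
  moreover have "{\<omega> \<in> space (Pr \<theta>0). \<theta>0 \<in> confidence_set N p f T1 T \<theta>hat \<alpha> (W \<omega>)} =
      space (Pr \<theta>0) - (W -` B \<inter> space (Pr \<theta>0))"
    using measurable_space[OF W_meas] by (auto simp: B_def)
  moreover have "W -` B \<inter> space (Pr \<theta>0) \<in> P.events"
    by (rule measurable_sets[OF W_meas B_sets])
  ultimately show ?thesis
    unfolding W_def[symmetric] by (simp add: P.prob_compl)
qed

end
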